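(* If $G$ is a collection of star-based numbers, i.e. $G=\sum_{i=1}^m\ast\!:\!x_i$ for a finite multiset $\{x_1,\dots,x_m\}$ of numbers, then $o^+(G)=o^-(G+\ast)$ and $o^+(G+\ast)=o^-(G)$.
   Context: Games are finite two-player (Left and Right) partizan game forms $G=\{\mathcal G^L\mid\mathcal G^R\}$, with disjunctive sum $G+H$ (a move is a move in exactly one summand); $0=\{\cdot\mid\cdot\}$ and $\ast=\{0\mid0\}$. Under normal play a player unable to move on their turn loses; under misère play a player unable to move on their turn wins. $o^+(G)$ and $o^-(G)$ denote the outcome class of $G$ under normal and misère play respectively: $\mathcal L$ (Left wins whoever starts), $\mathcal R$ (Right wins whoever starts), $\mathcal N$ (the player who moves first wins), $\mathcal P$ (the player who moves second wins). Numbers are dyadic rationals (positive, negative or zero), identified with their usual (normal-play canonical) game forms: $0=\{\cdot\mid\cdot\}$; $n=\{n-1\mid\cdot\}$ and $-n=\{\cdot\mid -(n-1)\}$ for positive integers $n$; $\frac{2p+1}{2^q}=\left\{\frac{p}{2^{q-1}}\,\middle|\,\frac{p+1}{2^{q-1}}\right\}$ for integers $p$ and $q\ge 1$. The ordinal sum is $G\!:\!H=\{\mathcal G^L,\,G\!:\!\mathcal H^L\mid \mathcal G^R,\,G\!:\!\mathcal H^R\}$. A star-based number is a game $\ast\!:\!x$ with $x$ a number (for $x=0$ this is $\ast$); a collection of them means their disjunctive sum. *)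

theory Defs
  imports Complex_Main "HOL-Library.FSet" "HOL-Library.Multiset"
begin

section \<open>Game forms\<close>

text \<open>Finite game forms: equality is identity of forms, not equality modulo outcomes.\<close>

datatype game = Game (lefts: "game fset") (rights: "game fset")

lemma size_lefts: "H |\<in>| lefts G \<Longrightarrow> size H < size G"
  by (cases G) (auto intro!: le_imp_less_Suc trans_le_add1 order_trans[OF _ member_le_sum[of H]])

lemma size_rights: "H |\<in>| rights G \<Longrightarrow> size H < size G"
  by (cases G) (auto intro!: le_imp_less_Suc trans_le_add2 order_trans[OF _ member_le_sum[of H]])

instantiation game :: comm_monoid_add
begin

definition zero_game :: game where
  "0 = Game {||} {||}"

context
  notes fimage_cong [fundef_cong]
begin

function plus_game :: "game \<Rightarrow> game \<Rightarrow> game" where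
  "plus_game G H =
     Game ((\<lambda>G'. plus_game G' H) |`| lefts G |\<union>| (\<lambda>H'. plus_game G H') |`| lefts H)
          ((\<lambda>G'. plus_game G' H) |`| rights G |\<union>| (\<lambda>H'. plus_game G H') |`| rights H)"
  by auto
termination
  by (relation "measure (\<lambda>(G, H). size G + size H)") (auto dest: size_lefts size_rights)

end

declare plus_game.simps [simp del]

lemma lefts_plus:
  "lefts (G + H) = (\<lambda>G'. G' + H) |`| lefts G |\<union>| (\<lambda>H'. G + H') |`| lefts H"
  by (subst plus_game.simps) simp

lemma rights_plus:
  "rights (G + H) = (\<lambda>G'. G' + H) |`| rights G |\<union>| (\<lambda>H'. G + H') |`| rights H"
  by (subst plus_game.simps) simp

instance
proof
  fix G H K :: game
  show "G + H + K = G + (H + K)"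
  proof (induction "size G + size H + size K" arbitrary: G H K rule: less_induct)
    case less
    show ?case
    proof (rule game.expand, intro conjI)
      have "\<And>G'. G' |\<in>| lefts G \<Longrightarrow> G' + H + K = G' + (H + K)"
           "\<And>H'. H' |\<in>| lefts H \<Longrightarrow> G + H' + K = G + (H' + K)"
           "\<And>K'. K' |\<in>| lefts K \<Longrightarrow> G + H + K' = G + (H + K')"
        using less size_lefts by simp_all
      then show "lefts (G + H + K) = lefts (G + (H + K))"
        by (simp add: lefts_plus fimage_funion fset.map_comp comp_def funion_assoc
              cong: fset.map_cong)
      have "\<And>G'. G' |\<in>| rights G \<Longrightarrow> G' + H + K = G' + (H + K)"
           "\<And>H'. H' |\<in>| rights H \<Longrightarrow> G + H' + K = G + (H' + K)"
           "\<And>K'. K' |\<in>| rights K \<Longrightarrow> G + H + K' = G + (H + K')"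
        using less size_rights by simp_all
      then show "rights (G + H + K) = rights (G + (H + K))"
        by (simp add: rights_plus fimage_funion fset.map_comp comp_def funion_assoc
              cong: fset.map_cong)
    qed
  qed
  show "G + H = H + G"
  proof (induction "size G + size H" arbitrary: G H rule: less_induct)
    case less
    show ?case
    proof (rule game.expand, intro conjI)
      have "\<And>G'. G' |\<in>| lefts G \<Longrightarrow> G' + H = H + G'"
           "\<And>H'. H' |\<in>| lefts H \<Longrightarrow> G + H' = H' + G"
        using less size_lefts by simp_all
      then show "lefts (G + H) = lefts (H + G)"
        by (simp add: lefts_plus funion_commute cong: fset.map_cong)
      have "\<And>G'. G' |\<in>| rights G \<Longrightarrow> G' + H = H + G'"
           "\<And>H'. H' |\<in>| rights H \<Longrightarrow> G + H' = H' + G"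
        using less size_rights by simp_all
      then show "rights (G + H) = rights (H + G)"
        by (simp add: rights_plus funion_commute cong: fset.map_cong)
    qed
  qed
  show "0 + G = G"
  proof (induction "size G" arbitrary: G rule: less_induct)
    case less
    have "\<And>G'. G' |\<in>| lefts G \<Longrightarrow> 0 + G' = G'" "\<And>G'. G' |\<in>| rights G \<Longrightarrow> 0 + G' = G'"
      using less size_lefts size_rights by simp_all
    then show ?case
      by (intro game.expand conjI)
         (simp_all add: lefts_plus rights_plus zero_game_def cong: fset.map_cong)
  qed
qed

end

definition star :: game where
  "star = Game {|0|} {|0|}"

primrec ordinal_sum :: "game \<Rightarrow> game \<Rightarrow> game" where
  "ordinal_sum G (Game L R) =
     Game (lefts G |\<union>| ordinal_sum G |`| L) (rights G |\<union>| ordinal_sum G |`| R)"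

section \<open>Outcomes\<close>

datatype player = Left | Right

fun opponent :: "player \<Rightarrow> player" where
  "opponent Left = Right"
| "opponent Right = Left"

fun moves :: "player \<Rightarrow> game \<Rightarrow> game fset" where
  "moves Left G = lefts G"
| "moves Right G = rights G"

lemma size_moves: "H |\<in>| moves p G \<Longrightarrow> size H < size G"
  by (cases p) (auto dest: size_lefts size_rights)

datatype convention = Normal | Misere

text \<open>
  \<open>wins_first c p G\<close>: player \<open>p\<close>, to move in \<open>G\<close>, wins under convention \<open>c\<close>. Play is finite
  and never drawn, so a position is won exactly if it is not won by the opponent.
\<close>

function wins_first :: "convention \<Rightarrow> player \<Rightarrow> game \<Rightarrow> bool" where
  "wins_first c p G \<longleftrightarrow>
     (if moves p G = {||} then c = Misere
      else fBex (moves p G) (\<lambda>G'. \<not> wins_first c (opponent p) G'))"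
  by auto
termination
  by (relation "measure (\<lambda>(c, p, G). size G)") (auto dest: size_moves)

declare wins_first.simps [simp del]

definition wins_second :: "convention \<Rightarrow> player \<Rightarrow> game \<Rightarrow> bool" where
  "wins_second c p G \<longleftrightarrow> \<not> wins_first c (opponent p) G"

datatype outcome_class = \<L> | \<R> | \<N> | \<P>

definition outcome :: "convention \<Rightarrow> game \<Rightarrow> outcome_class" where
  "outcome c G =
     (if wins_first c Left G \<and> wins_second c Left G then \<L>
      else if wins_first c Right G \<and> wins_second c Right G then \<R>
      else if wins_first c Left G \<and> wins_first c Right G then \<N>
      else \<P>)"

lemma outcome_iff:
  "outcome c G = \<L> \<longleftrightarrow> wins_first c Left G \<and> wins_second c Left G"
  "outcome c G = \<R> \<longleftrightarrow> wins_first c Right G \<and> wins_second c Right G"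
  "outcome c G = \<N> \<longleftrightarrow> wins_first c Left G \<and> wins_first c Right G"
  "outcome c G = \<P> \<longleftrightarrow> wins_second c Left G \<and> wins_second c Right G"
  by (auto simp: outcome_def wins_second_def)

abbreviation normal_outcome :: "game \<Rightarrow> outcome_class" (\<open>o\<^sup>+\<close>) where
  "o\<^sup>+ \<equiv> outcome Normal"

abbreviation misere_outcome :: "game \<Rightarrow> outcome_class" (\<open>o\<^sup>-\<close>) where
  "o\<^sup>- \<equiv> outcome Misere"

section \<open>Numbers\<close>

definition dyadic :: "rat \<Rightarrow> bool" where
  "dyadic x \<longleftrightarrow> (\<exists>(p::int) (q::nat). x = of_int p / 2 ^ q)"

primrec nat_game :: "nat \<Rightarrow> game" where
  "nat_game 0 = 0"
| "nat_game (Suc n) = Game {|nat_game n|} {||}"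

primrec neg_nat_game :: "nat \<Rightarrow> game" where
  "neg_nat_game 0 = 0"
| "neg_nat_game (Suc n) = Game {||} {|neg_nat_game n|}"

text \<open>\<open>dyadic_game p q\<close> is the canonical form of \<open>p / 2 ^ q\<close>, not assumed in lowest terms.\<close>

fun dyadic_game :: "int \<Rightarrow> nat \<Rightarrow> game" where
  "dyadic_game p 0 = (if 0 \<le> p then nat_game (nat p) else neg_nat_game (nat (- p)))"
| "dyadic_game p (Suc q) =
     (if even p then dyadic_game (p div 2) q
      else Game {|dyadic_game (p div 2) q|} {|dyadic_game (p div 2 + 1) q|})"

text \<open>
  The canonical form of a dyadic rational; the value at other rationals is irrelevant.
  The lemmas below recover the usual recursive description.
\<close>

definition number_game :: "rat \<Rightarrow> game" where
  "number_game x =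
     (let q = (LEAST q. x * 2 ^ q \<in> \<int>) in dyadic_game \<lfloor>x * 2 ^ q\<rfloor> q)"

lemma dyadic_game_cancel: "dyadic_game (p * 2 ^ k) (q + k) = dyadic_game p q"
  by (induction k) auto

lemma number_game_fraction: "number_game (of_int p / 2 ^ q) = dyadic_game p q"
proof -
  define x :: rat where "x = of_int p / 2 ^ q"
  define q0 where "q0 = (LEAST q. x * 2 ^ q \<in> \<int>)"
  have xq: "x * 2 ^ q = of_int p"
    by (simp add: x_def)
  then have ints: "x * 2 ^ q \<in> \<int>"
    by simp
  then have "x * 2 ^ q0 \<in> \<int>"
    unfolding q0_def by (rule LeastI)
  then obtain p0 where p0: "x * 2 ^ q0 = of_int p0"
    by (auto elim: Ints_cases)
  have "q0 \<le> q"
    unfolding q0_def using ints by (rule Least_le)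
  then obtain k where k: "q = q0 + k"
    using le_Suc_ex by blast
  have "(of_int p :: rat) = of_int (p0 * 2 ^ k)"
    using xq p0 by (simp add: k power_add flip: mult.assoc)
  then have "p = p0 * 2 ^ k"
    by (simp only: of_int_eq_iff)
  moreover have "number_game x = dyadic_game p0 q0"
    by (simp add: number_game_def Let_def p0 flip: q0_def)
  ultimately show ?thesis
    unfolding x_def [symmetric] by (simp add: dyadic_game_cancel k)
qed

lemma number_game_0: "number_game 0 = 0"
  using number_game_fraction[of 0 0] by simp

lemma number_game_pos: "number_game (of_nat (Suc n)) = Game {|number_game (of_nat n)|} {||}"
  using number_game_fraction[of "int (Suc n)" 0] number_game_fraction[of "int n" 0]
  by (simp add: nat_add_distrib)

lemma number_game_neg:
  "number_game (- of_nat (Suc n)) = Game {||} {|number_game (- of_nat n)|}"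
  using number_game_fraction[of "- int (Suc n)" 0] number_game_fraction[of "- int n" 0]
  by (cases n) (simp_all add: nat_add_distrib)

lemma number_game_frac:
  assumes "q \<ge> 1"
  shows "number_game (of_int (2 * p + 1) / 2 ^ q) =
    Game {|number_game (of_int p / 2 ^ (q - 1))|} {|number_game (of_int (p + 1) / 2 ^ (q - 1))|}"
proof -
  obtain q' where "q = Suc q'"
    using assms by (cases q) auto
  moreover have "(2 * p + 1) div 2 = p"
    by simp
  ultimately show ?thesis
    by (simp only: number_game_fraction) simp
qed

definition star_based_number :: "rat \<Rightarrow> game" where
  "star_based_number x = ordinal_sum star (number_game x)"

end

theory Submission
  imports Defs
begin

text \<open>
  The heart of the matter is that a player to move in a nonempty sum \<open>G\<close> of star-based numbers
  has, under normal play, no need of the extra star in \<open>G + \<ast>\<close>: if moving that star away wins,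
  then so does some move inside \<open>G\<close> (\<open>sprig_sum_winning_move\<close>). Granted this, the moves that
  decide normal play on \<open>G + \<ast>\<close> are those of misere play on \<open>G\<close>, with a star added to each
  result. When \<open>G\<close> is exhausted the star provides one last normal-play move, while under misere
  play the player to move wins at once. So induction shows that the same player wins \<open>G + \<ast>\<close>
  under normal play and \<open>G\<close> under misere play (\<open>misere_iff_normal_plus_star\<close>). As \<open>\<ast>\<close> is itself
  star-based and \<open>\<ast> + \<ast>\<close> equals \<open>0\<close> in normal play, the other equation is this one applied
  to \<open>G + \<ast>\<close>.

  To find the move inside \<open>G = \<Sum>\<^sub>i \<ast>:x\<^sub>i\<close> for Left, say (Right is symmetric), when \<open>G \<ge> 0\<close>, compare
  the summands with \<open>\<ast>\<close>: \<open>x \<ge> 0\<close> gives \<open>\<ast>:x \<ge> \<ast>\<close>, and \<open>x \<le> 0\<close> gives \<open>\<ast>:x \<le> \<ast>\<close>. If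
  some \<open>x\<^sub>i \<le> 0\<close>, Left deletes \<open>\<ast>:x\<^sub>i\<close>; what remains, together with \<open>\<ast>\<close>, is at least \<open>G\<close>.
  Otherwise every \<open>x\<^sub>i\<close> is positive, and so has a left option that is at least \<open>0\<close>. Left either
  deletes a summand or replaces its \<open>x\<^sub>i\<close> by such an option, whichever leaves, with the
  extra \<open>\<ast>\<close>, an even number of summands; that sum is at least an even number of stars, hence
  at least \<open>0\<close>.

  About numbers this uses only that neither they nor their subpositions are first-player wins.
\<close>

section \<open>Comparing games under normal play\<close>

lemma opponent_opponent [simp]: "opponent (opponent p) = p"
  by (cases p) auto

lemma moves_plus: "moves p (G + H) = (\<lambda>G'. G' + H) |`| moves p G |\<union>| (\<lambda>H'. G + H') |`| moves p H"
  by (cases p) (simp_all add: lefts_plus rights_plus)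

lemma moves_plus1: "G' |\<in>| moves p G \<Longrightarrow> G' + H |\<in>| moves p (G + H)"
  and moves_plus2: "H' |\<in>| moves p H \<Longrightarrow> G + H' |\<in>| moves p (G + H)"
  by (auto simp: moves_plus)

lemma moves_zero [simp]: "moves p 0 = {||}"
  by (cases p) (simp_all add: zero_game_def)

lemma moves_star [simp]: "moves p star = {|0|}"
  by (cases p) (simp_all add: star_def)

lemma wins_first_normal:
  "wins_first Normal p G \<longleftrightarrow> (\<exists>G'. G' |\<in>| moves p G \<and> wins_second Normal p G')"
  by (subst wins_first.simps) (auto simp: wins_second_def)

lemma wins_second_normal:
  "wins_second Normal p G \<longleftrightarrow> (\<forall>G'. G' |\<in>| moves (opponent p) G \<longrightarrow> wins_first Normal p G')"
  by (simp add: wins_second_def wins_first_normal[of "opponent p"])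

lemma wins_second_normal_reply:
  assumes "wins_second Normal p G" "G' |\<in>| moves (opponent p) G"
  obtains G'' where "G'' |\<in>| moves p G'" "wins_second Normal p G''"
proof -
  have "wins_first Normal p G'"
    using assms by (simp add: wins_second_normal)
  then show ?thesis
    using that by (auto simp: wins_first_normal)
qed

lemma wins_first_misere:
  "wins_first Misere p G \<longleftrightarrow>
    moves p G = {||} \<or> (\<exists>G'. G' |\<in>| moves p G \<and> \<not> wins_first Misere (opponent p) G')"
  by (subst wins_first.simps) auto

text \<open>
  For \<open>p = Left\<close> this is the normal-play order \<open>G \<ge> H\<close>, and for \<open>p = Right\<close> it is \<open>G \<le> H\<close>.
  Quantifying over all contexts makes it a preorder compatible with sums by construction, and
  indexing it by the player lets one argument serve both sides.
\<close>

definition prefers :: "player \<Rightarrow> game \<Rightarrow> game \<Rightarrow> bool" where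
  "prefers p G H \<longleftrightarrow> (\<forall>K.
    (wins_second Normal p (H + K) \<longrightarrow> wins_second Normal p (G + K)) \<and>
    (wins_first Normal p (H + K) \<longrightarrow> wins_first Normal p (G + K)))"

lemma prefers_refl [simp]: "prefers p G G"
  by (simp add: prefers_def)

lemma prefers_trans [trans]: "prefers p G H \<Longrightarrow> prefers p H K \<Longrightarrow> prefers p G K"
  by (simp add: prefers_def)

lemma prefers_plus1: "prefers p G H \<Longrightarrow> prefers p (G + K) (H + K)"
  by (simp add: prefers_def add.assoc)

lemma prefers_plus: "prefers p G H \<Longrightarrow> prefers p G' H' \<Longrightarrow> prefers p (G + G') (H + H')"
  by (metis add.commute prefers_plus1 prefers_trans)

lemma prefers_second: "prefers p G H \<Longrightarrow> wins_second Normal p H \<Longrightarrow> wins_second Normal p G"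
  by (metis add.commute add_0 prefers_def)

lemma prefers_first: "prefers p G H \<Longrightarrow> wins_first Normal p H \<Longrightarrow> wins_first Normal p G"
  by (metis add.commute add_0 prefers_def)

lemma wins_second_zero: "wins_second Normal p 0"
  by (simp add: wins_second_normal)

text \<open>
  In any context \<open>K\<close> a win on \<open>H + K\<close> is imitated on \<open>G + K\<close>: moves in \<open>K\<close> are copied, and a
  move in the changed summand is either matched by a move of the same player in the other one
  or answered at once by a reversing move. The reversing replies are what makes the criterion
  strong enough for \<open>\<ast>:x\<close> against \<open>\<ast>\<close>.
\<close>

lemma prefersI:
  assumes opp: "\<And>G'. G' |\<in>| moves (opponent p) G \<Longrightarrow>
      (\<exists>H'. H' |\<in>| moves (opponent p) H \<and> prefers p G' H') \<or>
      (\<exists>G''. G'' |\<in>| moves p G' \<and> prefers p G'' H)"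
    and own: "\<And>H'. H' |\<in>| moves p H \<Longrightarrow>
      (\<exists>G'. G' |\<in>| moves p G \<and> prefers p G' H') \<or>
      (\<exists>H''. H'' |\<in>| moves (opponent p) H' \<and> prefers p G H'')"
  shows "prefers p G H"
proof -
  have "(wins_second Normal p (H + K) \<longrightarrow> wins_second Normal p (G + K)) \<and>
        (wins_first Normal p (H + K) \<longrightarrow> wins_first Normal p (G + K))" for K
  proof (induction "size K" arbitrary: K rule: less_induct)
    case less
    have IH2: "wins_second Normal p (H + K') \<Longrightarrow> wins_second Normal p (G + K')"
      and IH1: "wins_first Normal p (H + K') \<Longrightarrow> wins_first Normal p (G + K')"
      if "K' |\<in>| moves q K" for K' q
      using less size_moves[OF that] by auto
    have second: "wins_second Normal p (G + K)" if win: "wins_second Normal p (H + K)"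
      unfolding wins_second_normal
    proof (intro allI impI)
      fix A assume "A |\<in>| moves (opponent p) (G + K)"
      then consider G' where "G' |\<in>| moves (opponent p) G" "A = G' + K"
        | K' where "K' |\<in>| moves (opponent p) K" "A = G + K'"
        by (auto simp: moves_plus)
      then show "wins_first Normal p A"
      proof cases
        case 1
        from opp[OF 1(1)] show ?thesis
        proof (elim disjE exE conjE)
          fix H' assume H': "H' |\<in>| moves (opponent p) H" "prefers p G' H'"
          have "wins_first Normal p (H' + K)"
            using win H'(1) moves_plus1 wins_second_normal by blast
          then show ?thesis
            using H'(2) 1(2) by (simp add: prefers_def)
        next
          fix G'' assume G'': "G'' |\<in>| moves p G'" "prefers p G'' H"
          have "wins_second Normal p (G'' + K)"
            using win G''(2) by (simp add: prefers_def)
          then show ?thesis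
            using G''(1) 1(2) moves_plus1 wins_first_normal by blast
        qed
      next
        case 2
        have "wins_first Normal p (H + K')"
          using win 2(1) moves_plus2 wins_second_normal by blast
        then show ?thesis
          using IH1 2 by blast
      qed
    qed
    have first: "wins_first Normal p (G + K)" if win: "wins_first Normal p (H + K)"
    proof -
      obtain A where A: "A |\<in>| moves p (H + K)" "wins_second Normal p A"
        using win wins_first_normal by blast
      from A(1) consider H' where "H' |\<in>| moves p H" "A = H' + K"
        | K' where "K' |\<in>| moves p K" "A = H + K'"
        by (auto simp: moves_plus)
      then show ?thesis
      proof cases
        case 1
        from own[OF 1(1)] show ?thesis
        proof (elim disjE exE conjE)
          fix G' assume G': "G' |\<in>| moves p G" "prefers p G' H'"
          have "wins_second Normal p (G' + K)"
            using A(2) 1(2) G'(2) by (simp add: prefers_def)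
          then show ?thesis
            using G'(1) moves_plus1 wins_first_normal by blast
        next
          fix H'' assume H'': "H'' |\<in>| moves (opponent p) H'" "prefers p G H''"
          have "wins_first Normal p (H'' + K)"
            using A(2) 1(2) H''(1) moves_plus1 wins_second_normal by blast
          then show ?thesis
            using H''(2) by (simp add: prefers_def)
        qed
      next
        case 2
        then show ?thesis
          using A(2) IH2 moves_plus2 wins_first_normal by blast
      qed
    qed
    from second first show ?case by blast
  qed
  then show ?thesis
    by (simp add: prefers_def)
qed

lemma prefers_star_star_zero: "prefers p (star + star) 0"
  by (rule prefersI) (auto simp: moves_plus)

lemma prefers_zero_star_star: "prefers p 0 (star + star)"
  by (rule prefersI) (auto simp: moves_plus)

section \<open>Ordinal sums over star\<close>

abbreviation sprig :: "game \<Rightarrow> game" where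
  "sprig \<equiv> ordinal_sum star"

lemma moves_sprig: "moves p (sprig g) = finsert 0 (sprig |`| moves p g)"
  by (cases g; cases p) (simp_all add: star_def)

lemma sprig_zero: "sprig 0 = star"
  by (simp add: zero_game_def star_def)

text \<open>
  Both players can turn either game into \<open>0\<close>. If the opponent moves inside \<open>g\<close> instead, the
  winning reply there leads to some \<open>g''\<close> that \<open>p\<close> again wins moving second, so the move
  reverses. The next lemma is the mirror image.
\<close>

lemma sprig_prefers_star: "wins_second Normal p g \<Longrightarrow> prefers p (sprig g) star"
proof (induction "size g" arbitrary: g rule: less_induct)
  case less
  show ?case
  proof (rule prefersI)
    fix A assume "A |\<in>| moves (opponent p) (sprig g)"
    then consider "A = 0" | g' where "g' |\<in>| moves (opponent p) g" "A = sprig g'"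
      by (auto simp: moves_sprig)
    then show "(\<exists>H'. H' |\<in>| moves (opponent p) star \<and> prefers p A H') \<or>
        (\<exists>A'. A' |\<in>| moves p A \<and> prefers p A' star)"
    proof cases
      case 2
      then obtain g'' where g'': "g'' |\<in>| moves p g'" "wins_second Normal p g''"
        using wins_second_normal_reply[OF less.prems 2(1)] by metis
      have "size g'' < size g"
        using size_moves[OF 2(1)] size_moves[OF g''(1)] by simp
      then have "prefers p (sprig g'') star"
        using less.hyps g''(2) by simp
      then show ?thesis
        using g''(1) 2(2) by (auto simp: moves_sprig)
    qed simp
  qed (auto simp: moves_sprig)
qed

lemma star_prefers_sprig: "wins_second Normal (opponent p) g \<Longrightarrow> prefers p star (sprig g)"
proof (induction "size g" arbitrary: g rule: less_induct)
  case less
  show ?case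
  proof (rule prefersI)
    fix A assume "A |\<in>| moves p (sprig g)"
    then consider "A = 0" | g' where "g' |\<in>| moves p g" "A = sprig g'"
      by (auto simp: moves_sprig)
    then show "(\<exists>H'. H' |\<in>| moves p star \<and> prefers p H' A) \<or>
        (\<exists>A'. A' |\<in>| moves (opponent p) A \<and> prefers p star A')"
    proof cases
      case 2
      then obtain g'' where g'': "g'' |\<in>| moves (opponent p) g'" "wins_second Normal (opponent p) g''"
        using wins_second_normal_reply[of "opponent p" g g'] less.prems by auto
      have "size g'' < size g"
        using size_moves[OF 2(1)] size_moves[OF g''(1)] by simp
      then have "prefers p star (sprig g'')"
        using less.hyps g''(2) by simp
      then show ?thesis
        using g''(1) 2(2) by (auto simp: moves_sprig)
    qed simp
  qed (auto simp: moves_sprig)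
qed

abbreviation sprig_sum :: "game multiset \<Rightarrow> game" where
  "sprig_sum Y \<equiv> (\<Sum>y \<in># Y. sprig y)"

lemma sprig_sum_prefers_parity:
  "(\<forall>y \<in># Y. wins_second Normal p y) \<Longrightarrow>
    prefers p (sprig_sum Y) (if even (size Y) then 0 else star)"
proof (induction Y)
  case (add y Y)
  then have "prefers p (sprig y + sprig_sum Y) (star + (if even (size Y) then 0 else star))"
    by (intro prefers_plus sprig_prefers_star) auto
  also have "prefers p \<dots> (if even (size (add_mset y Y)) then 0 else star)"
    using prefers_star_star_zero by simp
  finally show ?case by simp
qed simp

lemma moves_sprig_sum:
  assumes "A |\<in>| moves p (sprig_sum Y)"
  obtains y Z where "Y = add_mset y Z" "A = sprig_sum Z"
    | y y' Z where "Y = add_mset y Z" "y' |\<in>| moves p y" "A = sprig_sum (add_mset y' Z)"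
  using assms
proof (induction Y arbitrary: A thesis)
  case (add x Y)
  from add.prems(3) consider A' where "A' |\<in>| moves p (sprig x)" "A = A' + sprig_sum Y"
    | B where "B |\<in>| moves p (sprig_sum Y)" "A = sprig x + B"
    by (auto simp: moves_plus)
  then show ?case
  proof cases
    case 1
    then show ?thesis
      using add.prems(1,2) by (auto simp: moves_sprig)
  next
    case 2
    show ?thesis
    proof (rule add.IH[OF _ _ 2(1)])
      fix y Z assume "Y = add_mset y Z" "B = sprig_sum Z"
      then show ?thesis
        using add.prems(1)[of y "add_mset x Z"] 2(2) by (simp add: add_mset_commute)
    next
      fix y y' Z assume "Y = add_mset y Z" "y' |\<in>| moves p y" "B = sprig_sum (add_mset y' Z)"
      then show ?thesis
        using add.prems(2)[of y "add_mset x Z" y'] 2(2)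
        by (simp add: add_mset_commute add.left_commute)
    qed
  qed
qed simp

section \<open>Misere play as normal play with an extra star\<close>

text \<open>
  That no \<open>y\<close> is a first-player win makes the case distinction exhaustive: if \<open>y \<le> 0\<close> fails
  (in the order of \<open>p\<close>), then \<open>p\<close> wins \<open>y\<close> moving first as well as second.
\<close>

lemma sprig_sum_winning_move:
  assumes nonempty: "Y \<noteq> {#}"
    and signed: "\<forall>y \<in># Y. outcome Normal y \<noteq> \<N>"
    and win: "wins_second Normal p (sprig_sum Y)"
  obtains A where "A |\<in>| moves p (sprig_sum Y)" "wins_second Normal p (A + star)"
proof (cases "\<exists>y \<in># Y. wins_second Normal (opponent p) y")
  case True
  then obtain y Z where y: "Y = add_mset y Z" "wins_second Normal (opponent p) y"
    by (metis multi_member_split)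
  have "prefers p (star + sprig_sum Z) (sprig_sum Y)"
    using y by (auto intro: prefers_plus1 star_prefers_sprig)
  then have "wins_second Normal p (sprig_sum Z + star)"
    using win prefers_second by (metis add.commute)
  moreover have "sprig_sum Z |\<in>| moves p (sprig_sum Y)"
    using moves_plus1[of 0 p "sprig y" "sprig_sum Z"] y(1) by (simp add: moves_sprig)
  ultimately show ?thesis
    using that by blast
next
  case False
  have pos: "wins_first Normal p y" "wins_second Normal p y" if "y \<in># Y" for y
    using that False signed
    by (cases p; force simp: outcome_iff wins_second_def)+
  obtain y Z where Y: "Y = add_mset y Z"
    using nonempty by (metis multiset_cases)
  show ?thesis
  \<comment> \<open>The multiset element \<open>0\<close> below represents the extra star, as \<open>\<ast>:0 = \<ast>\<close>.\<close>
  proof (cases "even (size Y)")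
    case True
    have "prefers p (sprig_sum (add_mset 0 Z)) 0"
      using sprig_sum_prefers_parity[of "add_mset 0 Z" p] pos Y True
      by (auto simp: wins_second_zero)
    then have "wins_second Normal p (sprig_sum Z + star)"
      using prefers_second wins_second_zero by (fastforce simp: sprig_zero add.commute)
    moreover have "sprig_sum Z |\<in>| moves p (sprig_sum Y)"
      using moves_plus1[of 0 p "sprig y" "sprig_sum Z"] Y by (simp add: moves_sprig)
    ultimately show ?thesis
      using that by blast
  next
    case False
    obtain y' where y': "y' |\<in>| moves p y" "wins_second Normal p y'"
      using pos(1)[of y] Y wins_first_normal by auto
    have "prefers p (sprig_sum (add_mset 0 (add_mset y' Z))) 0"
      using sprig_sum_prefers_parity[of "add_mset 0 (add_mset y' Z)" p] pos Y y'(2) False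
      by (auto simp: wins_second_zero)
    then have "wins_second Normal p (sprig_sum (add_mset y' Z) + star)"
      using prefers_second wins_second_zero by (fastforce simp: sprig_zero add.commute)
    moreover have "sprig_sum (add_mset y' Z) |\<in>| moves p (sprig_sum Y)"
      using moves_plus1[of "sprig y'" p "sprig y" "sprig_sum Z"] Y y'(1)
      by (simp add: moves_sprig)
    ultimately show ?thesis
      using that by blast
  qed
qed

text \<open>
  Compare the winning moves of the two sides: by induction the moves inside the sum correspond,
  so the only discrepancy is the normal-play option of moving the extra star to \<open>0\<close>, which
  \<open>sprig_sum_winning_move\<close> shows to be dispensable. Closure of \<open>S\<close> under moves keeps the positions
  reached within the scope of that lemma.
\<close>

lemma misere_iff_normal_plus_star:
  assumes closed: "\<And>y y' q. y \<in> S \<Longrightarrow> y' |\<in>| moves q y \<Longrightarrow> y' \<in> S"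
    and signed: "\<And>y. y \<in> S \<Longrightarrow> outcome Normal y \<noteq> \<N>"
    and "set_mset Y \<subseteq> S"
  shows "wins_first Misere p (sprig_sum Y) \<longleftrightarrow> wins_first Normal p (sprig_sum Y + star)"
  using \<open>set_mset Y \<subseteq> S\<close>
proof (induction "size (sprig_sum Y)" arbitrary: Y p rule: less_induct)
  case less
  let ?G = "sprig_sum Y"
  have IH: "wins_first Misere (opponent p) A \<longleftrightarrow> \<not> wins_second Normal p (A + star)"
    if A: "A |\<in>| moves p ?G" for A
  proof -
    obtain Y' where "A = sprig_sum Y'" "set_mset Y' \<subseteq> S"
      using A
    proof (cases rule: moves_sprig_sum)
      case (1 y Z)
      then show ?thesis
        using that[of Z] less.prems by simp
    next
      case (2 y y' Z)
      then show ?thesis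
        using that[of "add_mset y' Z"] less.prems closed[of y y' p] by simp
    qed
    moreover from this have "wins_first Misere (opponent p) (sprig_sum Y') \<longleftrightarrow>
        wins_first Normal (opponent p) (sprig_sum Y' + star)"
      using less.hyps[of Y' "opponent p"] size_moves[OF A] by simp
    ultimately show ?thesis
      by (simp add: wins_second_def)
  qed
  have normal: "wins_first Normal p (?G + star) \<longleftrightarrow>
      (\<exists>A. A |\<in>| moves p ?G \<and> wins_second Normal p (A + star)) \<or> wins_second Normal p ?G"
    unfolding wins_first_normal[of p "?G + star"] by (auto simp: moves_plus)
  show ?case
  proof (cases "Y = {#}")
    case True
    then show ?thesis
      using normal wins_second_zero by (simp add: wins_first_misere[of p 0])
  next
    case False
    then obtain y Z where "Y = add_mset y Z"
      by (metis multiset_cases)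
    then have "moves p ?G \<noteq> {||}"
      by (simp add: moves_plus moves_sprig)
    then have "wins_first Misere p ?G \<longleftrightarrow>
        (\<exists>A. A |\<in>| moves p ?G \<and> wins_second Normal p (A + star))"
      unfolding wins_first_misere[of p ?G] using IH by metis
    moreover have "\<exists>A. A |\<in>| moves p ?G \<and> wins_second Normal p (A + star)"
      if "wins_second Normal p ?G"
    proof -
      have "\<forall>y \<in># Y. outcome Normal y \<noteq> \<N>"
        using signed less.prems by blast
      then show ?thesis
        using sprig_sum_winning_move[OF False _ that] by metis
    qed
    ultimately show ?thesis
      using normal by blast
  qed
qed

section \<open>Numbers are not first-player wins\<close>

text \<open>
  The four claims are proved together because an odd numerator links them: the opponent of the
  player with the advantage can only move to a number still strictly in that player's favour,
  whereas the player with a strict advantage can move to one that is at least neutral.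
\<close>

lemma dyadic_game_sign:
  "(0 \<le> p \<longrightarrow> wins_second Normal Left (dyadic_game p q)) \<and>
   (0 < p \<longrightarrow> wins_first Normal Left (dyadic_game p q)) \<and>
   (p \<le> 0 \<longrightarrow> wins_second Normal Right (dyadic_game p q)) \<and>
   (p < 0 \<longrightarrow> wins_first Normal Right (dyadic_game p q))"
proof (induction q arbitrary: p)
  case 0
  have L2: "wins_second Normal Left (nat_game n)" for n
    by (cases n) (simp_all add: wins_second_normal zero_game_def)
  have R2: "wins_second Normal Right (neg_nat_game n)" for n
    by (cases n) (simp_all add: wins_second_normal zero_game_def)
  have L1: "wins_first Normal Left (nat_game (Suc n))" for n
    using L2 by (simp add: wins_first_normal)
  have R1: "wins_first Normal Right (neg_nat_game (Suc n))" for n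
    using R2 by (simp add: wins_first_normal)
  consider "p = 0" | n where "p = int (Suc n)" | n where "p = - int (Suc n)"
    by (cases p rule: int_cases3) (metis gr0_implies_Suc)+
  then show ?case
  proof cases
    case 1
    then show ?thesis
      using L2[of 0] R2[of 0] by simp
  next
    case 2
    then have "dyadic_game p 0 = nat_game (Suc n)"
      by (simp only: dyadic_game.simps nat_int) simp
    then show ?thesis
      using 2 L1[of n] L2[of "Suc n"] by simp
  next
    case 3
    then have "dyadic_game p 0 = neg_nat_game (Suc n)"
      by (simp only: dyadic_game.simps minus_minus nat_int) simp
    then show ?thesis
      using 3 R1[of n] R2[of "Suc n"] by simp
  qed
next
  case (Suc q)
  show ?case
  proof (cases "even p")
    case True
    then obtain k where "p = 2 * k"
      by (rule evenE)
    then show ?thesis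
      using Suc.IH[of k] by simp
  next
    case False
    then obtain k where k: "p = 2 * k + 1"
      by (auto elim: oddE)
    have "(2 * k + 1) div 2 = k"
      by simp
    then have *: "dyadic_game p (Suc q) = Game {|dyadic_game k q|} {|dyadic_game (k + 1) q|}"
      using k by simp
    have L1: "wins_first Normal Left (Game {|g|} {|h|}) \<longleftrightarrow> wins_second Normal Left g"
      and R1: "wins_first Normal Right (Game {|g|} {|h|}) \<longleftrightarrow> wins_second Normal Right h"
      and L2: "wins_second Normal Left (Game {|g|} {|h|}) \<longleftrightarrow> wins_first Normal Left h"
      and R2: "wins_second Normal Right (Game {|g|} {|h|}) \<longleftrightarrow> wins_first Normal Right g" for g h
      by (simp_all add: wins_first_normal[of _ "Game _ _"] wins_second_normal[of _ "Game _ _"])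
    show ?thesis
      unfolding * L1 R1 L2 R2 using Suc.IH[of k] Suc.IH[of "k + 1"] k by auto
  qed
qed

lemma outcome_dyadic_game: "outcome Normal (dyadic_game p q) \<noteq> \<N>"
  using dyadic_game_sign[of p q] by (cases "0 \<le> p") (auto simp: outcome_iff wins_second_def)

lemma moves_dyadic_game:
  "g |\<in>| moves r (dyadic_game p q) \<Longrightarrow> \<exists>p' q'. g = dyadic_game p' q'"
proof (induction q arbitrary: p)
  case 0
  have nat: "nat_game n = dyadic_game (int n) 0" for n
    by simp
  have neg: "neg_nat_game n = dyadic_game (- int n) 0" for n
    by (cases "n = 0") simp_all
  have "\<exists>n. g = nat_game n \<or> g = neg_nat_game n"
    using 0 by (cases "nat p"; cases "nat (- p)"; cases r) (auto simp: zero_game_def split: if_splits)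
  then show ?case
  proof (elim exE disjE)
    fix n assume "g = nat_game n"
    then show ?thesis
      unfolding nat by blast
  next
    fix n assume "g = neg_nat_game n"
    then show ?thesis
      unfolding neg by blast
  qed
next
  case (Suc q)
  show ?case
  proof (cases "even p")
    case True
    then show ?thesis
      using Suc by simp
  next
    case False
    then have "g = dyadic_game (p div 2) q \<or> g = dyadic_game (p div 2 + 1) q"
      using Suc.prems by (cases r) simp_all
    then show ?thesis
      by blast
  qed
qed

theorem corollary5p2:
  fixes X :: "rat multiset" and G :: game
  assumes "\<forall>x \<in># X. dyadic x"
    and "G = (\<Sum>x \<in># X. star_based_number x)"
  shows "o\<^sup>+ G = o\<^sup>- (G + star) \<and> o\<^sup>+ (G + star) = o\<^sup>- G"
proof -
  define S where "S = {g. \<exists>p q. g = dyadic_game p q}"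
  define Y where "Y = image_mset number_game X"
  have G: "G = sprig_sum Y"
    by (simp add: assms(2) Y_def star_based_number_def image_mset.compositionality comp_def)
  have "number_game x \<in> S" if "x \<in># X" for x
  proof -
    have "dyadic x"
      using that assms(1) by blast
    then obtain p q where "x = of_int p / 2 ^ q"
      unfolding dyadic_def by blast
    then have "number_game x = dyadic_game p q"
      by (simp only: number_game_fraction)
    then show ?thesis
      unfolding S_def by blast
  qed
  then have Y: "set_mset Y \<subseteq> S"
    by (auto simp: Y_def)
  have "0 = dyadic_game 0 0"
    by simp
  then have zero: "0 \<in> S"
    unfolding S_def by blast
  have closed: "g' \<in> S" if "g \<in> S" "g' |\<in>| moves r g" for g g' r
    using that moves_dyadic_game unfolding S_def by blast
  have signed: "outcome Normal g \<noteq> \<N>" if "g \<in> S" for g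
    using that outcome_dyadic_game unfolding S_def by blast
  have misere: "wins_first Misere p (sprig_sum Z) \<longleftrightarrow> wins_first Normal p (sprig_sum Z + star)"
    if "set_mset Z \<subseteq> S" for Z p
    using closed signed that by (rule misere_iff_normal_plus_star)
  have one: "wins_first Normal p (G + star) \<longleftrightarrow> wins_first Misere p G" for p
    using misere[OF Y] G by simp
  have "wins_first Misere p (G + star) \<longleftrightarrow> wins_first Normal p (G + star + star)" for p
    using misere[of "add_mset 0 Y"] Y zero by (simp add: G sprig_zero add.commute)
  moreover have "prefers p (G + star + star) G" "prefers p G (G + star + star)" for p
    using prefers_plus1[OF prefers_star_star_zero, of p G]
      prefers_plus1[OF prefers_zero_star_star, of p G]
    by (simp_all add: ac_simps)
  ultimately have two: "wins_first Normal p G \<longleftrightarrow> wins_first Misere p (G + star)" for p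
    using prefers_first by blast
  from one two show ?thesis
    by (simp add: outcome_def wins_second_def)
qed

end
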